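(* For each composition $\alpha$, with $n=|\alpha|$, we have: (a) $\mathcal D_\alpha(1,0)=M_\alpha$; (b) $\mathcal D_\alpha(-1,1)=\Lambda^*_\alpha$; (c) $\mathcal D_\alpha(1,-1)=E_\alpha$; (d) $2^n\mathcal D_\alpha(2,-1)=\eta_\alpha$; (e) $(q+1)^n\mathcal D_\alpha(q+1,-1)=\eta^{(q)}_\alpha$.
   Context: A composition is a finite (possibly empty) tuple $\alpha=(\alpha_1,\dots,\alpha_l)$ of positive integers; $\ell(\alpha)=l$, $|\alpha|=\sum\alpha_i$. Write $\beta\succeq\alpha$ if $\alpha$ refines $\beta$, i.e. $\beta$ is obtained from $\alpha$ by adding together some adjacent parts. $M_\alpha=\sum_{i_1<\dots<i_l}x_{i_1}^{\alpha_1}\cdots x_{i_l}^{\alpha_l}$ is the monomial quasisymmetric function. For $|\alpha|=n$, $$\mathcal D_\alpha(q,t)=\sum_{\beta\succeq\alpha}q^{\ell(\beta)-n}(-t)^{\ell(\alpha)-\ell(\beta)}M_\beta,$$ and $\mathcal D_\alpha(a,b)$ denotes the substitution $q\mapsto a$, $t\mapsto b$ (with $0^0=1$). $\mathrm{NSym}$ is the free associative algebra on $S_1,S_2,\dots$, with basis $S_\alpha=S_{\alpha_1}\cdots S_{\alpha_l}$, dual to $\mathrm{QSym}$ via $\langle S_\alpha,M_\beta\rangle=\delta_{\alpha\beta}$; the elementary noncommutative symmetric functions are $\Lambda_n=\sum_{|\alpha|=n}(-1)^{n-\ell(\alpha)}S_\alpha$ and $\Lambda_\alpha=\Lambda_{\alpha_1}\cdots\Lambda_{\alpha_l}$;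 $\{\Lambda^*_\alpha\}$ is the basis of $\mathrm{QSym}$ dual to $\{\Lambda_\alpha\}$. The essential quasisymmetric function is $E_\alpha=\sum_{\beta\succeq\alpha}M_\beta$; the enriched monomial quasisymmetric function is $\eta_\alpha=\sum_{\beta\succeq\alpha}2^{\ell(\beta)}M_\beta$; the enriched $q$-monomial quasisymmetric function is $\eta^{(q)}_\alpha=\sum_{\beta\succeq\alpha}(q+1)^{\ell(\beta)}M_\beta$. *)

theory Defs
  imports Complex_Main "HOL-Library.Poly_Mapping" "HOL-Library.Function_Algebras"
begin

section \<open>Compositions\<close>

text \<open>Compositions form the free monoid on the positive integers, written additively
  (concatenation is \<open>+\<close>, the empty composition is \<open>0\<close>), so that
  \<^typ>\<open>'a \<Rightarrow>\<^sub>0 'b\<close> with \<open>'a\<close> the type of compositions is its monoid algebra.\<close>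

typedef composition = "{xs :: nat list. 0 \<notin> set xs}"
  morphisms parts Composition
  by (rule exI[of _ "[]"]) simp

lemma parts_pos: "0 \<notin> set (parts \<alpha>)"
  using parts[of \<alpha>] by simp

instantiation composition :: monoid_add
begin

definition zero_composition :: composition where
  "0 = Composition []"

definition plus_composition :: "composition \<Rightarrow> composition \<Rightarrow> composition" where
  "\<alpha> + \<beta> = Composition (parts \<alpha> @ parts \<beta>)"

lemma parts_zero [simp]: "parts 0 = []"
  by (simp add: zero_composition_def Composition_inverse)

lemma parts_plus [simp]: "parts (\<alpha> + \<beta>) = parts \<alpha> @ parts \<beta>"
  by (simp add: plus_composition_def Composition_inverse parts_pos)

instance
  by standard (simp_all add: parts_inject [symmetric])

end

definition clen :: "composition \<Rightarrow> nat" where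
  "clen \<alpha> = length (parts \<alpha>)"

definition csize :: "composition \<Rightarrow> nat" where
  "csize \<alpha> = sum_list (parts \<alpha>)"

text \<open>\<open>\<beta> \<succeq> \<alpha>\<close>: cutting \<open>\<alpha>\<close> into nonempty blocks of consecutive parts and adding up each block
  gives \<open>\<beta>\<close>.\<close>

definition coarsens :: "composition \<Rightarrow> composition \<Rightarrow> bool" (infix "\<succeq>" 50) where
  "\<beta> \<succeq> \<alpha> \<longleftrightarrow>
     (\<exists>bs. [] \<notin> set bs \<and> concat bs = parts \<alpha> \<and> map sum_list bs = parts \<beta>)"

lemma finite_csize: "finite {\<alpha>. csize \<alpha> = n}"
proof (rule finite_imageD)
  have len: "length xs \<le> sum_list xs" if "0 \<notin> set xs" for xs :: "nat list"
    using that by (induction xs) auto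
  have "parts ` {\<alpha>. csize \<alpha> = n} \<subseteq> {xs. set xs \<subseteq> {..n} \<and> length xs \<le> n}"
    using len parts_pos by (auto simp: csize_def member_le_sum_list)
  then show "finite (parts ` {\<alpha>. csize \<alpha> = n})"
    by (rule finite_subset) (rule finite_lists_length_le, simp)
  show "inj_on parts {\<alpha>. csize \<alpha> = n}"
    by (simp add: inj_on_def parts_inject)
qed

lemma coarsens_csize: "\<beta> \<succeq> \<alpha> \<Longrightarrow> csize \<beta> = csize \<alpha>"
proof -
  have "sum_list (concat bs) = sum_list (map sum_list bs)" for bs :: "nat list list"
    by (induction bs) simp_all
  then show "\<beta> \<succeq> \<alpha> \<Longrightarrow> csize \<beta> = csize \<alpha>"
    unfolding coarsens_def csize_def by metis
qed

lemma coarsens_clen: "\<beta> \<succeq> \<alpha> \<Longrightarrow> clen \<beta> \<le> clen \<alpha>"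
proof -
  have "[] \<notin> set bs \<Longrightarrow> length bs \<le> length (concat bs)" for bs :: "nat list list"
  proof (induction bs)
    case (Cons b bs)
    then show ?case by (cases b) auto
  qed simp
  then show "\<beta> \<succeq> \<alpha> \<Longrightarrow> clen \<beta> \<le> clen \<alpha>"
    unfolding coarsens_def clen_def by (metis length_map)
qed

lemma finite_coarsens: "finite {\<beta>. \<beta> \<succeq> \<alpha>}"
  by (rule finite_subset[OF _ finite_csize[of "csize \<alpha>"]]) (auto dest: coarsens_csize)

section \<open>Quasisymmetric functions\<close>

text \<open>A formal power series in infinitely many variables, given by its coefficients; a monomial is
  its finitely supported exponent function. The variables are indexed by \<open>0, 1, 2, \<dots>\<close>, so the
  variable with index \<open>i\<close> is \<open>x\<^bsub>i+1\<^esub>\<close>. Only the vector space structure is used below;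
  the product that \<^theory>\<open>HOL-Library.Function_Algebras\<close> puts on this type is pointwise and is
  not the product of power series.\<close>

type_synonym 'k series = "(nat \<Rightarrow>\<^sub>0 nat) \<Rightarrow> 'k"

definition scale :: "'k::field \<Rightarrow> 'k series \<Rightarrow> 'k series" (infixr "*\<^sub>s" 75) where
  "c *\<^sub>s f = (\<lambda>m. c * f m)"

lemma vector_space_scale: "vector_space (scale :: 'k::field \<Rightarrow> _)"
  by standard (auto simp: scale_def fun_eq_iff algebra_simps)

definition monomial :: "nat list \<Rightarrow> nat list \<Rightarrow> nat \<Rightarrow>\<^sub>0 nat" where
  "monomial is as = sum_list (map2 Poly_Mapping.single is as)"

text \<open>The coefficient of \<open>m\<close> counts the sequences \<open>i\<^sub>1 < \<dots> < i\<^sub>l\<close> contributing \<open>m\<close> to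
  the defining sum (there is at most one).\<close>

definition M :: "composition \<Rightarrow> 'k::field series" where
  "M \<alpha> = (\<lambda>m. of_nat (card {is. length is = clen \<alpha> \<and> sorted_wrt (<) is \<and>
                                monomial is (parts \<alpha>) = m}))"

definition QSym :: "'k::field series set" where
  "QSym = module.span scale (range M)"

text \<open>\<open>q\<close> and \<open>t\<close> are elements of a field; for the generic object take indeterminates of a
  rational function field. The exponent of \<open>q\<close> is at most \<open>0\<close>, that of \<open>- t\<close> is at least \<open>0\<close>
  (see \<open>coarsens_clen\<close>).\<close>

definition D :: "composition \<Rightarrow> 'k::field \<Rightarrow> 'k \<Rightarrow> 'k series" where
  "D \<alpha> q t = (\<Sum>\<beta> | \<beta> \<succeq> \<alpha>.
     (q powi (int (clen \<beta>) - int (csize \<alpha>)) * (- t) ^ (clen \<alpha> - clen \<beta>)) *\<^sub>s M \<beta>)"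

definition essential :: "composition \<Rightarrow> 'k::field series" where
  "essential \<alpha> = (\<Sum>\<beta> | \<beta> \<succeq> \<alpha>. M \<beta>)"

definition eta :: "composition \<Rightarrow> 'k::field series" where
  "eta \<alpha> = (\<Sum>\<beta> | \<beta> \<succeq> \<alpha>. 2 ^ clen \<beta> *\<^sub>s M \<beta>)"

definition eta_q :: "'k::field \<Rightarrow> composition \<Rightarrow> 'k series" where
  "eta_q q \<alpha> = (\<Sum>\<beta> | \<beta> \<succeq> \<alpha>. (q + 1) ^ clen \<beta> *\<^sub>s M \<beta>)"

section \<open>Noncommutative symmetric functions and duality\<close>

text \<open>The free associative algebra on \<open>S\<^sub>1, S\<^sub>2, \<dots>\<close>; the product is convolution. The
  generator \<open>S n\<close> is meaningful for \<open>n \<ge> 1\<close> only.\<close>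

type_synonym 'k nsym = "composition \<Rightarrow>\<^sub>0 'k"

definition S :: "nat \<Rightarrow> 'k::field nsym" where
  "S n = Poly_Mapping.single (Composition [n]) 1"

definition S_comp :: "composition \<Rightarrow> 'k::field nsym" where
  "S_comp \<alpha> = prod_list (map S (parts \<alpha>))"

lemma S_comp_eq_single: "(S_comp \<alpha> :: 'k::field nsym) = Poly_Mapping.single \<alpha> 1"
proof -
  have "0 \<notin> set xs \<Longrightarrow>
      prod_list (map S xs) = (Poly_Mapping.single (Composition xs) 1 :: 'k nsym)" for xs
  proof (induction xs)
    case Nil
    show ?case by (simp add: single_one flip: zero_composition_def)
  next
    case (Cons x xs)
    then show ?case
      by (simp add: S_def mult_single plus_composition_def Composition_inverse)
  qed
  from this[OF parts_pos[of \<alpha>]] show ?thesis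
    by (simp add: S_comp_def parts_inverse)
qed

definition Lam :: "nat \<Rightarrow> 'k::field nsym" where
  "Lam n = (\<Sum>\<alpha> | csize \<alpha> = n. (- 1) ^ (n - clen \<alpha>) * S_comp \<alpha>)"

definition Lam_comp :: "composition \<Rightarrow> 'k::field nsym" where
  "Lam_comp \<alpha> = prod_list (map Lam (parts \<alpha>))"

text \<open>The bilinear pairing with \<open>\<langle>S\<^sub>\<alpha>, M\<^sub>\<beta>\<rangle> = \<delta>\<^sub>\<alpha>\<^sub>\<beta>\<close>: by \<open>S_comp_eq_single\<close> the coordinate of \<open>F\<close>
  at \<open>S\<^sub>\<alpha>\<close> is \<open>lookup F \<alpha>\<close>; the other factor is the coordinate of \<open>f \<in> QSym\<close> at \<open>M\<^sub>\<alpha>\<close>.\<close>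

definition pairing :: "'k::field nsym \<Rightarrow> 'k series \<Rightarrow> 'k" where
  "pairing F f = (\<Sum>\<alpha> \<in> Poly_Mapping.keys F.
     Poly_Mapping.lookup F \<alpha> * module.representation scale (range M) f (M \<alpha>))"

definition Lam_dual :: "composition \<Rightarrow> 'k::field series" where
  "Lam_dual \<alpha> =
     (THE f. f \<in> QSym \<and> (\<forall>\<beta>. pairing (Lam_comp \<beta>) f = (if \<beta> = \<alpha> then 1 else 0)))"

end

theory Submission
  imports Defs
begin

text \<open>Everything except the evaluation at \<open>(-1, 1)\<close> is a comparison of coefficients. At
  \<open>t = 0\<close> the power \<open>(- t) ^ (clen \<alpha> - clen \<beta>)\<close> leaves only the coarsenings of the same length as
  \<open>\<alpha>\<close>, that is \<open>\<alpha>\<close> itself. At \<open>t = -1\<close> the power of \<open>- t\<close> is \<open>1\<close>, and multiplying by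
  \<open>c ^ csize \<alpha>\<close> turns the coefficient \<open>c powi (clen \<beta> - csize \<alpha>)\<close> into \<open>c ^ clen \<beta>\<close>; the values
  \<open>c = 1\<close>, \<open>c = 2\<close> and \<open>c = q + 1\<close> give the essential and the two enriched monomial functions
  (\<open>rescaled_D_eq\<close>).

  At \<open>(-1, 1)\<close> the claim is one of duality. The series \<open>D \<alpha> (-1) 1\<close> is the sum of the \<open>M \<gamma>\<close> over
  \<open>\<gamma> \<succeq> \<alpha>\<close>, up to the sign \<open>(-1) ^ (csize \<alpha> - clen \<alpha>)\<close>. Multiplying out the product of the
  \<open>\<Lambda>\<^sub>n\<close> shows that \<open>\<Lambda>\<^sub>\<beta>\<close> is the signed sum of the \<open>S\<^sub>\<gamma>\<close> over all refinements \<open>\<gamma>\<close> of \<open>\<beta>\<close>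
  (\<open>Lam_comp_expansion\<close>), so the pairing of the two is the sum of \<open>(-1) ^ (clen \<alpha> - clen \<gamma>)\<close> over
  the interval \<open>\<beta> \<succeq> \<gamma> \<succeq> \<alpha>\<close>. Recording a composition by its partial sums turns refinement into
  inclusion of finite sets (\<open>coarsens_iff_psums\<close>), hence the interval into a Boolean lattice, over
  which an alternating sum vanishes unless the lattice is a point
  (\<open>alternating_sum_composition_interval\<close>).

  Being dual to \<open>\<Lambda>\<close> characterises a quasisymmetric function. Evaluating a series at one monomial
  per composition reads off its coordinates in the basis \<open>M\<close> (\<open>M_coordinate\<close>), and the matrix that
  expresses \<open>\<Lambda>\<close> in terms of \<open>S\<close> is triangular for the refinement order, with signs on the diagonal
  (\<open>Lam_pairing_determines\<close>).\<close>

interpretation series: vector_space "scale :: 'k::field \<Rightarrow> 'k series \<Rightarrow> 'k series"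
  by (rule vector_space_scale)

section \<open>Refinement as inclusion of sets of partial sums\<close>

text \<open>Stated on lists of parts, so that the tails arising in inductions need not be wrapped up
  as compositions.\<close>

definition coarsens_list :: "nat list \<Rightarrow> nat list \<Rightarrow> bool" where
  "coarsens_list ys xs \<longleftrightarrow> (\<exists>bs. [] \<notin> set bs \<and> concat bs = xs \<and> map sum_list bs = ys)"

lemma coarsens_iff_list: "\<beta> \<succeq> \<alpha> \<longleftrightarrow> coarsens_list (parts \<beta>) (parts \<alpha>)"
  by (simp add: coarsens_def coarsens_list_def)

lemma coarsens_list_Nil [simp]: "coarsens_list [] xs \<longleftrightarrow> xs = []"
  by (auto simp: coarsens_list_def)

lemma coarsens_list_Cons:
  "coarsens_list (y # ys) xs \<longleftrightarrow>
     (\<exists>u v. u \<noteq> [] \<and> xs = u @ v \<and> sum_list u = y \<and> coarsens_list ys v)"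
proof
  assume "coarsens_list (y # ys) xs"
  then obtain bs where bs: "[] \<notin> set bs" "concat bs = xs" "map sum_list bs = y # ys"
    unfolding coarsens_list_def by (elim exE conjE) (rule that)
  then obtain u cs where "bs = u # cs" by (cases bs) auto
  with bs show "\<exists>u v. u \<noteq> [] \<and> xs = u @ v \<and> sum_list u = y \<and> coarsens_list ys v"
    by (intro exI[of _ u] exI[of _ "concat cs"]) (auto simp: coarsens_list_def)
next
  assume "\<exists>u v. u \<noteq> [] \<and> xs = u @ v \<and> sum_list u = y \<and> coarsens_list ys v"
  then obtain u bs where "u \<noteq> []" "xs = u @ concat bs" "sum_list u = y"
    "[] \<notin> set bs" "map sum_list bs = ys"
    by (auto simp: coarsens_list_def)
  then show "coarsens_list (y # ys) xs"
    unfolding coarsens_list_def by (intro exI[of _ "u # bs"]) auto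
qed

text \<open>The partial sums are taken from the right, including \<open>0\<close> and the total: consing a part
  then only adds a new maximum, which keeps the inductions free of shifts.\<close>

fun suffix_sums :: "nat list \<Rightarrow> nat set" where
  "suffix_sums [] = {0}"
| "suffix_sums (x # xs) = insert (x + sum_list xs) (suffix_sums xs)"

lemma finite_suffix_sums [simp]: "finite (suffix_sums xs)"
  by (induction xs) auto

lemma suffix_sums_le: "s \<in> suffix_sums xs \<Longrightarrow> s \<le> sum_list xs"
  by (induction xs) auto

lemma sum_list_in_suffix_sums [simp]: "sum_list xs \<in> suffix_sums xs"
  by (induction xs) auto

lemma zero_in_suffix_sums [simp]: "0 \<in> suffix_sums xs"
  by (induction xs) auto

lemma card_suffix_sums: "0 \<notin> set xs \<Longrightarrow> card (suffix_sums xs) = Suc (length xs)"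
proof (induction xs)
  case (Cons x xs)
  then have "x + sum_list xs \<notin> suffix_sums xs"
    using suffix_sums_le[of "x + sum_list xs" xs] by auto
  with Cons show ?case by simp
qed simp

lemma suffix_sums_append_subset: "suffix_sums v \<subseteq> suffix_sums (u @ v)"
  by (induction u) auto

lemma coarsens_list_imp_subset:
  "coarsens_list ys xs \<Longrightarrow> sum_list ys = sum_list xs \<and> suffix_sums ys \<subseteq> suffix_sums xs"
proof (induction ys arbitrary: xs)
  case (Cons y ys)
  then obtain u v where uv: "xs = u @ v" "sum_list u = y" "coarsens_list ys v"
    by (auto simp: coarsens_list_Cons)
  with Cons.IH[OF uv(3)] suffix_sums_append_subset[of v u] sum_list_in_suffix_sums[of xs]
  show ?case by auto
qed simp

text \<open>Induction on the finer list: compare the totals of the two tails. If they agree, the two heads agree and form a block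
  of their own. Otherwise the head of the coarser list is the larger one; subtracting from it the
  head of the finer list leaves a coarsening of the finer tail, to whose first block that head is
  then added.\<close>

lemma subset_imp_coarsens_list:
  "0 \<notin> set xs \<Longrightarrow> 0 \<notin> set ys \<Longrightarrow> sum_list ys = sum_list xs \<Longrightarrow>
     suffix_sums ys \<subseteq> suffix_sums xs \<Longrightarrow> coarsens_list ys xs"
proof (induction xs arbitrary: ys)
  case Nil
  then show ?case by (cases ys) auto
next
  case (Cons a xs)
  from Cons.prems obtain b ys' where ys: "ys = b # ys'"
    by (cases ys) auto
  have pos: "a > 0" "b > 0" "0 \<notin> set xs" "0 \<notin> set ys'"
    using Cons.prems ys by auto
  have sum: "b + sum_list ys' = a + sum_list xs"
    using Cons.prems ys by simp
  have sub: "suffix_sums ys' \<subseteq> suffix_sums xs"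
    using Cons.prems(4) ys sum pos suffix_sums_le[of _ ys'] by fastforce
  show ?case
  proof (cases "sum_list ys' = sum_list xs")
    case True
    with Cons.IH[OF pos(3,4) True sub] sum show ?thesis
      unfolding ys coarsens_list_Cons by (intro exI[of _ "[a]"] exI[of _ xs]) simp
  next
    case False
    moreover have "sum_list ys' \<le> sum_list xs"
      using sub suffix_sums_le sum_list_in_suffix_sums by blast
    ultimately have lt: "b > a" "(b - a) + sum_list ys' = sum_list xs"
      using sum by auto
    have "coarsens_list ((b - a) # ys') xs"
      using Cons.IH[of "(b - a) # ys'"] pos lt sub by simp
    then obtain u v where "u \<noteq> []" "xs = u @ v" "sum_list u = b - a" "coarsens_list ys' v"
      by (auto simp: coarsens_list_Cons)
    then show ?thesis
      using lt unfolding ys coarsens_list_Cons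
      by (intro exI[of _ "a # u"] exI[of _ v]) simp
  qed
qed

definition psums :: "composition \<Rightarrow> nat set" where
  "psums \<alpha> = suffix_sums (parts \<alpha>)"

lemma coarsens_iff_psums: "\<beta> \<succeq> \<alpha> \<longleftrightarrow> csize \<beta> = csize \<alpha> \<and> psums \<beta> \<subseteq> psums \<alpha>"
  using coarsens_list_imp_subset subset_imp_coarsens_list parts_pos
  unfolding coarsens_iff_list csize_def psums_def by blast

lemma card_psums: "card (psums \<alpha>) = Suc (clen \<alpha>)"
  by (simp add: psums_def clen_def card_suffix_sums parts_pos)

lemma finite_psums [simp]: "finite (psums \<alpha>)"
  by (simp add: psums_def)

lemma Max_psums: "Max (psums \<alpha>) = csize \<alpha>"
  unfolding psums_def csize_def by (intro Max_eqI) (auto simp: suffix_sums_le)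

text \<open>Equal sets give \<open>\<beta> \<succeq> \<alpha>\<close> with equal lengths, so that every block consists of a single
  part.\<close>

lemma psums_eq_iff: "psums \<alpha> = psums \<beta> \<longleftrightarrow> \<alpha> = \<beta>"
proof
  have eq: "xs = ys" if "0 \<notin> set xs" "0 \<notin> set ys" "coarsens_list ys xs" "length xs = length ys"
    for xs ys
    using that
  proof (induction ys arbitrary: xs)
    case (Cons y ys)
    then obtain u v where uv: "u \<noteq> []" "xs = u @ v" "sum_list u = y" "coarsens_list ys v"
      by (auto simp: coarsens_list_Cons)
    have "length ys \<le> length v"
      using coarsens_clen[of "Composition ys" "Composition v"] uv Cons.prems
      by (simp add: coarsens_iff_list Composition_inverse clen_def)
    moreover have "length u + length v = Suc (length ys)" "length u > 0"
      using uv Cons.prems by auto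
    ultimately have "length u = 1" "length v = length ys" by linarith+
    then obtain a where "u = [a]" "length v = length ys"
      by (cases u) auto
    with uv Cons show ?case by auto
  qed simp
  assume *: "psums \<alpha> = psums \<beta>"
  then have "csize \<alpha> = csize \<beta>" "clen \<alpha> = clen \<beta>"
    using Max_psums card_psums by (metis, metis nat.inject)
  with * have "\<beta> \<succeq> \<alpha>" by (simp add: coarsens_iff_psums)
  then show "\<alpha> = \<beta>"
    using eq[of "parts \<alpha>" "parts \<beta>"] \<open>clen \<alpha> = clen \<beta>\<close>
    by (simp add: coarsens_iff_list clen_def parts_pos parts_inject)
qed simp

lemma coarsens_refl: "\<alpha> \<succeq> \<alpha>"
  by (simp add: coarsens_iff_psums)

lemma coarsens_clen_eq: "\<beta> \<succeq> \<alpha> \<Longrightarrow> clen \<beta> = clen \<alpha> \<Longrightarrow> \<beta> = \<alpha>"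
  by (metis card_psums card_subset_eq coarsens_iff_psums finite_psums psums_eq_iff)

text \<open>Adding the elements of the set in increasing order, each new maximum is reached by a new
  first part, its distance to the previous maximum.\<close>

lemma psums_surj:
  assumes "finite A" "0 \<in> A"
  obtains \<alpha> where "psums \<alpha> = A"
proof -
  have "\<exists>xs. 0 \<notin> set xs \<and> suffix_sums xs = insert 0 A"
    using assms(1)
  proof (induction rule: finite_linorder_max_induct)
    case empty
    show ?case by (intro exI[of _ "[]"]) simp
  next
    case (insert b A)
    then obtain xs where xs: "0 \<notin> set xs" "suffix_sums xs = insert 0 A"
      by blast
    show ?case
    proof (cases "b = 0")
      case True
      with xs show ?thesis by auto
    next
      case False
      have "sum_list xs \<in> insert 0 A"
        using xs(2) sum_list_in_suffix_sums by blast
      with insert.hyps(2) False have "sum_list xs < b" by (metis gr0I insertE)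
      with xs show ?thesis
        by (intro exI[of _ "(b - sum_list xs) # xs"] conjI) auto
    qed
  qed
  then obtain xs where "0 \<notin> set xs" "suffix_sums xs = A"
    using assms(2) by (auto simp: insert_absorb)
  then show ?thesis
    using that[of "Composition xs"] by (simp add: psums_def Composition_inverse)
qed

text \<open>Toggling the membership of a fixed element of \<open>A - B\<close> is a sign-reversing involution of
  the interval.\<close>

lemma alternating_sum_set_interval:
  fixes A B :: "'a set"
  assumes "finite A" "B \<subset> A"
  shows "(\<Sum>C | B \<subseteq> C \<and> C \<subseteq> A. (- 1) ^ card C) = (0 :: 'k::field_char_0)"
proof -
  obtain x where x: "x \<in> A" "x \<notin> B" using assms by auto
  let ?t = "\<lambda>C. if x \<in> C then C - {x} else insert x C"
  let ?I = "{C. B \<subseteq> C \<and> C \<subseteq> A}"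
  have "(\<Sum>C\<in>?I. (- 1) ^ card C) = (\<Sum>C\<in>?I. - ((- 1) ^ card C) :: 'k)"
  proof (rule sum.reindex_bij_witness[where i = ?t and j = ?t])
    fix C assume C: "C \<in> ?I"
    then have "finite C" using assms finite_subset by auto
    show "?t (?t C) = C" "?t (?t C) = C" by auto
    show "?t C \<in> ?I" "?t C \<in> ?I" using C x by auto
    show "- ((- 1) ^ card (?t C)) = ((- 1) ^ card C :: 'k)"
    proof (cases "x \<in> C")
      case True
      then obtain k where "card C = Suc k"
        using \<open>finite C\<close> by (metis card.remove)
      with True show ?thesis by simp
    next
      case False
      then show ?thesis using \<open>finite C\<close> by simp
    qed
  qed
  then have "2 * (\<Sum>C\<in>?I. (- 1) ^ card C) = (0 :: 'k)"
    by (simp add: sum_negf)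
  then show ?thesis by simp
qed

text \<open>The map \<open>psums\<close> identifies the interval with one of finite sets; the sign is thus the
  Moebius function of the refinement order.\<close>

lemma alternating_sum_composition_interval:
  "(\<Sum>\<gamma> | \<beta> \<succeq> \<gamma> \<and> \<gamma> \<succeq> \<alpha>. (- 1) ^ (clen \<alpha> - clen \<gamma>)) =
     (if \<beta> = \<alpha> then 1 else 0 :: 'k::field_char_0)"
proof (cases "\<beta> \<succeq> \<alpha>")
  case False
  then have "{\<gamma>. \<beta> \<succeq> \<gamma> \<and> \<gamma> \<succeq> \<alpha>} = {}"
    by (auto simp: coarsens_iff_psums)
  with False show ?thesis using coarsens_refl by (simp only: sum.empty) auto
next
  case True
  show ?thesis
  proof (cases "\<beta> = \<alpha>")
    case True
    then have "{\<gamma>. \<beta> \<succeq> \<gamma> \<and> \<gamma> \<succeq> \<alpha>} = {\<alpha>}"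
      using coarsens_iff_psums psums_eq_iff by auto
    with True show ?thesis by simp
  next
    case False
    with True have sub: "psums \<beta> \<subset> psums \<alpha>" and size: "csize \<beta> = csize \<alpha>"
      by (auto simp: coarsens_iff_psums psums_eq_iff)
    have bij: "bij_betw psums {\<gamma>. \<beta> \<succeq> \<gamma> \<and> \<gamma> \<succeq> \<alpha>} {C. psums \<beta> \<subseteq> C \<and> C \<subseteq> psums \<alpha>}"
    proof (rule bij_betw_imageI)
      show "psums ` {\<gamma>. \<beta> \<succeq> \<gamma> \<and> \<gamma> \<succeq> \<alpha>} = {C. psums \<beta> \<subseteq> C \<and> C \<subseteq> psums \<alpha>}"
      proof (intro equalityI subsetI)
        fix C assume C: "C \<in> {C. psums \<beta> \<subseteq> C \<and> C \<subseteq> psums \<alpha>}"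
        then have fin: "finite C" using finite_subset[OF _ finite_psums] by auto
        have "0 \<in> C" using C by (auto simp: psums_def)
        then obtain \<gamma> where \<gamma>: "psums \<gamma> = C" using psums_surj fin by metis
        (* The size of a composition is the maximum of its set, and the ends have equal size. *)
        have "psums \<beta> \<noteq> {}" unfolding psums_def using zero_in_suffix_sums by blast
        then have "Max (psums \<beta>) \<le> Max C" "Max C \<le> Max (psums \<alpha>)"
          using C fin by (auto intro!: Max_mono)
        then have "csize \<gamma> = csize \<alpha>"
          using size by (simp add: \<gamma>[symmetric] Max_psums)
        then show "C \<in> psums ` {\<gamma>. \<beta> \<succeq> \<gamma> \<and> \<gamma> \<succeq> \<alpha>}"
          using C \<gamma> size by (auto simp: coarsens_iff_psums intro!: image_eqI[of _ _ \<gamma>])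
      qed (auto simp: coarsens_iff_psums)
    qed (simp add: inj_on_def psums_eq_iff)
    (* The cardinality of psums is one more than the length; this shift is the Suc in the sign. *)
    have "(\<Sum>\<gamma> | \<beta> \<succeq> \<gamma> \<and> \<gamma> \<succeq> \<alpha>. (- 1) ^ (clen \<alpha> - clen \<gamma>)) =
          (\<Sum>\<gamma> | \<beta> \<succeq> \<gamma> \<and> \<gamma> \<succeq> \<alpha>. (- 1) ^ Suc (clen \<alpha>) * (- 1) ^ card (psums \<gamma>) :: 'k)"
      by (intro sum.cong refl)
        (auto dest!: coarsens_clen simp: card_psums minus_one_power_iff)
    also have "\<dots> = (- 1) ^ Suc (clen \<alpha>) * (\<Sum>C | psums \<beta> \<subseteq> C \<and> C \<subseteq> psums \<alpha>. (- 1) ^ card C)"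
      by (simp add: sum_distrib_left sum.reindex_bij_betw[OF bij, symmetric])
    finally show ?thesis
      using False sub by (simp add: alternating_sum_set_interval)
  qed
qed

section \<open>Coordinates of quasisymmetric functions\<close>

text \<open>The monomial \<open>x\<^sub>1^\<alpha>\<^sub>1 \<cdots> x\<^sub>l^\<alpha>\<^sub>l\<close>, in which only \<open>M \<alpha>\<close> has a nonzero coefficient;
  evaluation at it is the coordinate functional of \<open>M \<alpha>\<close>.\<close>

definition lead_monomial :: "composition \<Rightarrow> nat \<Rightarrow>\<^sub>0 nat" where
  "lead_monomial \<alpha> = monomial [0..<clen \<alpha>] (parts \<alpha>)"

lemma lookup_monomial_notin:
  "length is = length as \<Longrightarrow> i \<notin> set is \<Longrightarrow> Poly_Mapping.lookup (monomial is as) i = 0"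
  by (induction "is" as rule: list_induct2) (auto simp: monomial_def lookup_add lookup_single)

lemma map_lookup_monomial:
  "length is = length as \<Longrightarrow> distinct is \<Longrightarrow>
     map (Poly_Mapping.lookup (monomial is as)) is = as"
proof (induction "is" as rule: list_induct2)
  case (Cons i "is" a as)
  have eq: "monomial (i # is) (a # as) = Poly_Mapping.single i a + monomial is as"
    by (simp add: monomial_def)
  have "map (Poly_Mapping.lookup (monomial (i # is) (a # as))) is =
        map (Poly_Mapping.lookup (monomial is as)) is"
    using Cons.prems by (intro map_cong) (auto simp: eq lookup_add lookup_single when_def)
  moreover have "Poly_Mapping.lookup (monomial (i # is) (a # as)) i = a"
    using Cons by (simp add: eq lookup_add lookup_monomial_notin)
  ultimately show ?case
    using Cons by (simp del: map_eq_conv)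
qed simp

lemma keys_monomial:
  assumes "length is = length as" "distinct is" "0 \<notin> set as"
  shows "Poly_Mapping.keys (monomial is as) = set is"
proof -
  have "Poly_Mapping.lookup (monomial is as) i \<noteq> 0" if "i \<in> set is" for i
    using that assms(3) map_lookup_monomial[OF assms(1,2)] by (metis image_eqI list.set_map)
  then show ?thesis
    using lookup_monomial_notin[OF assms(1)] by (auto simp: in_keys_iff)
qed

text \<open>The support of the monomial determines the increasing index sequence, and its exponents
  along that sequence are the parts.\<close>

lemma M_lead_monomial: "M \<beta> (lead_monomial \<alpha>) = (if \<beta> = \<alpha> then 1 else 0 :: 'k::field)"
proof -
  have "is = [0..<clen \<alpha>] \<and> \<beta> = \<alpha>"
    if "length is = clen \<beta>" "sorted_wrt (<) is" "monomial is (parts \<beta>) = lead_monomial \<alpha>" for "is"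
  proof -
    have d: "distinct is" using that(2) strict_sorted_iff by blast
    have len: "length is = length (parts \<beta>)" using that(1) by (simp add: clen_def)
    have "set is = set [0..<clen \<alpha>]"
      using keys_monomial[OF len d parts_pos]
        keys_monomial[of "[0..<clen \<alpha>]" "parts \<alpha>"] that(3)
      by (simp add: lead_monomial_def clen_def parts_pos)
    then have "is": "is = [0..<clen \<alpha>]"
      using that(2) by (intro strict_sorted_equal) auto
    have "parts \<beta> = parts \<alpha>"
      using map_lookup_monomial[OF len d] map_lookup_monomial[of "[0..<clen \<alpha>]" "parts \<alpha>"] that(3)
      by (simp add: lead_monomial_def clen_def "is")
    with "is" show ?thesis by (simp add: parts_inject)
  qed
  then have "{is. length is = clen \<beta> \<and> sorted_wrt (<) is \<and>
                monomial is (parts \<beta>) = lead_monomial \<alpha>} =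
             (if \<beta> = \<alpha> then {[0..<clen \<alpha>]} else {})"
    by (auto simp: lead_monomial_def strict_sorted_iff)
  then show ?thesis by (simp add: M_def)
qed

lemma inj_M: "inj (M :: composition \<Rightarrow> 'k::field series)"
  by (rule injI) (metis M_lead_monomial one_neq_zero)

lemma sum_series_apply: "(sum f A :: 'k::field series) m = (\<Sum>a\<in>A. f a m)"
  by (induction A rule: infinite_finite_induct) auto

lemma M_combination_lead_monomial:
  assumes "finite T" "T \<subseteq> range (M :: composition \<Rightarrow> 'k::field series)"
  shows "(\<Sum>v\<in>T. u v *\<^sub>s v) (lead_monomial \<alpha>) = (if M \<alpha> \<in> T then u (M \<alpha>) else 0)"
proof -
  have "v (lead_monomial \<alpha>) = (if v = M \<alpha> then 1 else 0)" if "v \<in> T" for v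
    using that assms(2) by (auto simp: M_lead_monomial inj_eq[OF inj_M])
  then have "(\<Sum>v\<in>T. u v *\<^sub>s v) (lead_monomial \<alpha>) = (\<Sum>v\<in>T. if v = M \<alpha> then u v else 0)"
    unfolding sum_series_apply scale_def by (intro sum.cong refl) (metis mult_1_right mult_zero_right)
  then show ?thesis using assms(1) by simp
qed

lemma independent_M: "\<not> series.dependent (range (M :: composition \<Rightarrow> 'k::field series))"
  unfolding series.independent_explicit_module
proof (intro allI impI)
  fix T :: "'k series set" and u v
  assume T: "finite T" "T \<subseteq> range M" "(\<Sum>v\<in>T. u v *\<^sub>s v) = 0" "v \<in> T"
  then obtain \<alpha> where "v = M \<alpha>" by auto
  with T show "u v = 0"
    using M_combination_lead_monomial[OF T(1,2), of u \<alpha>] by simp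
qed

text \<open>This replaces the abstract coordinates in the definition of the pairing by plain
  coefficients, which are visibly linear.\<close>

lemma M_coordinate:
  assumes "f \<in> QSym"
  shows "series.representation (range M) f (M \<alpha>) = f (lead_monomial \<alpha>)"
proof -
  let ?r = "series.representation (range M) f"
  let ?T = "{v. ?r v \<noteq> 0}"
  have "?T \<subseteq> range M" "finite ?T"
    using series.representation_ne_zero series.finite_representation by auto
  moreover have "(\<Sum>v\<in>?T. ?r v *\<^sub>s v) = f"
    using series.sum_nonzero_representation_eq[OF independent_M] assms by (simp add: QSym_def)
  ultimately show ?thesis
    using M_combination_lead_monomial[of ?T ?r \<alpha>] by auto
qed

lemma QSym_eqI:
  fixes f g :: "'k::field series"
  assumes "f \<in> QSym" "g \<in> QSym" "\<And>\<alpha>. f (lead_monomial \<alpha>) = g (lead_monomial \<alpha>)"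
  shows "f = g"
proof -
  let ?r = "series.representation (range M)"
  have "?r f = ?r g"
  proof
    fix v show "?r f v = ?r g v"
    proof (cases "v \<in> range M")
      case True
      then obtain \<alpha> where "v = M \<alpha>" by auto
      then show ?thesis
        using assms M_coordinate[of f \<alpha>] M_coordinate[of g \<alpha>] by simp
    next
      case False
      then have "?r h v = 0" for h :: "'k series"
        using series.representation_ne_zero[of "range M" h v] by blast
      then show ?thesis by simp
    qed
  qed
  then have "(\<Sum>v | ?r f v \<noteq> 0. ?r f v *\<^sub>s v) = (\<Sum>v | ?r g v \<noteq> 0. ?r g v *\<^sub>s v)"
    by (rule arg_cong)
  with assms(1,2) show ?thesis
    unfolding QSym_def by (simp only: series.sum_nonzero_representation_eq[OF independent_M])
qed

section \<open>Pairing with the elementary basis\<close>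

text \<open>The coefficient of \<open>S\<^sub>\<gamma>\<close> in \<open>\<Lambda>\<^sub>\<beta>\<close> for a refinement \<open>\<gamma>\<close> of \<open>\<beta>\<close>. Writing the exponent with
  \<open>csize \<gamma>\<close> instead of \<open>csize \<beta>\<close> makes it multiplicative and independent of \<open>\<beta>\<close>.\<close>

definition composition_sign :: "composition \<Rightarrow> 'k::field" where
  "composition_sign \<gamma> = (- 1) ^ (csize \<gamma> - clen \<gamma>)"

lemma clen_le_csize: "clen \<alpha> \<le> csize \<alpha>"
proof -
  have "0 \<notin> set xs \<Longrightarrow> length xs \<le> sum_list xs" for xs :: "nat list"
    by (induction xs) auto
  then show ?thesis by (simp add: clen_def csize_def parts_pos)
qed

lemma csize_plus [simp]: "csize (\<alpha> + \<beta>) = csize \<alpha> + csize \<beta>"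
  by (simp add: csize_def)

lemma clen_plus [simp]: "clen (\<alpha> + \<beta>) = clen \<alpha> + clen \<beta>"
  by (simp add: clen_def)

lemma composition_sign_plus: "composition_sign (\<alpha> + \<beta>) = composition_sign \<alpha> * composition_sign \<beta>"
  using clen_le_csize[of \<alpha>] clen_le_csize[of \<beta>]
  by (simp add: composition_sign_def flip: power_add)

lemma Lam_expansion: "Lam n = (\<Sum>\<gamma> | csize \<gamma> = n. Poly_Mapping.single \<gamma> (composition_sign \<gamma>))"
  unfolding Lam_def
proof (intro sum.cong refl)
  fix \<gamma> assume "\<gamma> \<in> {\<gamma>. csize \<gamma> = n}"
  then show "(- 1) ^ (n - clen \<gamma>) * S_comp \<gamma> = Poly_Mapping.single \<gamma> (composition_sign \<gamma> :: 'a)"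
    by (auto simp: S_comp_eq_single composition_sign_def minus_one_power_iff single_uminus)
qed

lemma append_sum_list_eqD:
  fixes us :: "nat list"
  assumes "us @ vs = us' @ vs'" "sum_list us = sum_list us'" "0 \<notin> set us" "0 \<notin> set us'"
  shows "us = us' \<and> vs = vs'"
  using assms
proof (induction us arbitrary: us')
  case Nil
  then show ?case by (cases us') auto
next
  case (Cons u us)
  then show ?case by (cases us') auto
qed

text \<open>A refinement of \<open>(n, \<beta>\<^sub>1, \<dots>)\<close> splits uniquely after the parts that make up \<open>n\<close>: a prefix
  of positive parts is determined by its sum.\<close>

lemma bij_betw_refinements:
  assumes "n > 0"
  shows "bij_betw (\<lambda>(\<gamma>, \<delta>). \<gamma> + \<delta>) ({\<gamma>. csize \<gamma> = n} \<times> {\<delta>. \<beta> \<succeq> \<delta>})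
           {\<gamma>. Composition [n] + \<beta> \<succeq> \<gamma>}"
proof (rule bij_betw_imageI)
  show "inj_on (\<lambda>(\<gamma>, \<delta>). \<gamma> + \<delta>) ({\<gamma>. csize \<gamma> = n} \<times> {\<delta>. \<beta> \<succeq> \<delta>})"
  proof (rule inj_onI, clarify)
    fix \<gamma> \<delta> \<gamma>' \<delta>'
    assume "\<gamma> + \<delta> = \<gamma>' + \<delta>'" "n = csize \<gamma>" "csize \<gamma>' = csize \<gamma>"
    then have "parts \<gamma> @ parts \<delta> = parts \<gamma>' @ parts \<delta>'" "sum_list (parts \<gamma>) = sum_list (parts \<gamma>')"
      by (metis parts_plus, simp add: csize_def)
    from append_sum_list_eqD[OF this parts_pos parts_pos] show "\<gamma> = \<gamma>' \<and> \<delta> = \<delta>'"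
      by (simp add: parts_inject)
  qed
  have parts_Cons: "parts (Composition [n] + \<beta>) = n # parts \<beta>"
    using assms by (simp add: Composition_inverse)
  show "(\<lambda>(\<gamma>, \<delta>). \<gamma> + \<delta>) ` ({\<gamma>. csize \<gamma> = n} \<times> {\<delta>. \<beta> \<succeq> \<delta>}) = {\<gamma>. Composition [n] + \<beta> \<succeq> \<gamma>}"
  proof (intro equalityI subsetI)
    fix \<epsilon> assume "\<epsilon> \<in> (\<lambda>(\<gamma>, \<delta>). \<gamma> + \<delta>) ` ({\<gamma>. csize \<gamma> = n} \<times> {\<delta>. \<beta> \<succeq> \<delta>})"
    then obtain \<gamma> \<delta> where "\<epsilon> = \<gamma> + \<delta>" "csize \<gamma> = n" "\<beta> \<succeq> \<delta>" by auto
    moreover from this assms have "parts \<gamma> \<noteq> []" by (auto simp: csize_def)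
    ultimately show "\<epsilon> \<in> {\<gamma>. Composition [n] + \<beta> \<succeq> \<gamma>}"
      unfolding mem_Collect_eq coarsens_iff_list parts_Cons coarsens_list_Cons
      by (intro exI[of _ "parts \<gamma>"] exI[of _ "parts \<delta>"]) (simp add: csize_def)
  next
    fix \<epsilon> assume "\<epsilon> \<in> {\<gamma>. Composition [n] + \<beta> \<succeq> \<gamma>}"
    then obtain u v where uv: "parts \<epsilon> = u @ v" "sum_list u = n" "coarsens_list (parts \<beta>) v"
      unfolding mem_Collect_eq coarsens_iff_list parts_Cons coarsens_list_Cons by auto
    have "0 \<notin> set u" "0 \<notin> set v" using parts_pos[of \<epsilon>] uv by auto
    with uv have "\<epsilon> = Composition u + Composition v" "csize (Composition u) = n"
      "\<beta> \<succeq> Composition v"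
      by (auto simp: csize_def coarsens_iff_list Composition_inverse simp flip: parts_inject)
    then show "\<epsilon> \<in> (\<lambda>(\<gamma>, \<delta>). \<gamma> + \<delta>) ` ({\<gamma>. csize \<gamma> = n} \<times> {\<delta>. \<beta> \<succeq> \<delta>})"
      by (intro image_eqI[of _ _ "(Composition u, Composition v)"]) auto
  qed
qed

lemma finite_refinements: "finite {\<gamma>. \<beta> \<succeq> \<gamma>}"
  by (rule finite_subset[OF _ finite_csize[of "csize \<beta>"]]) (auto dest: coarsens_csize)

text \<open>Multiplying out \<open>\<Lambda>\<^sub>n \<Lambda>\<^sub>\<beta>\<close> runs over all pairs of a composition of \<open>n\<close> and a refinement of
  \<open>\<beta>\<close>, and concatenating such pairs gives every refinement of \<open>(n, \<beta>\<^sub>1, \<dots>)\<close> once.\<close>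

lemma Lam_comp_expansion:
  "Lam_comp \<beta> = (\<Sum>\<gamma> | \<beta> \<succeq> \<gamma>. Poly_Mapping.single \<gamma> (composition_sign \<gamma> :: 'k::field))"
proof -
  have "0 \<notin> set xs \<Longrightarrow> prod_list (map Lam xs) =
      (\<Sum>\<gamma> | Composition xs \<succeq> \<gamma>. Poly_Mapping.single \<gamma> (composition_sign \<gamma> :: 'k))" for xs
  proof (induction xs)
    case Nil
    have "{\<gamma>. 0 \<succeq> \<gamma>} = {0}"
      by (auto simp: coarsens_iff_list simp flip: parts_inject)
    then show ?case
      by (simp add: composition_sign_def csize_def single_one flip: zero_composition_def)
  next
    case (Cons n xs)
    then have eq: "Composition (n # xs) = Composition [n] + Composition xs"
      by (simp add: plus_composition_def Composition_inverse)
    have "prod_list (map Lam (n # xs)) =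
      (\<Sum>(\<gamma>, \<delta>) \<in> {\<gamma>. csize \<gamma> = n} \<times> {\<delta>. Composition xs \<succeq> \<delta>}.
         Poly_Mapping.single (\<gamma> + \<delta>) (composition_sign (\<gamma> + \<delta>) :: 'k))"
      using Cons by (simp add: Lam_expansion[of n] sum_product sum.cartesian_product mult_single
          composition_sign_plus)
    also have "\<dots> = (\<Sum>\<gamma> | Composition (n # xs) \<succeq> \<gamma>. Poly_Mapping.single \<gamma> (composition_sign \<gamma>))"
      unfolding eq using bij_betw_refinements[of n "Composition xs"] Cons.prems
      by (subst sum.reindex_bij_betw[symmetric, OF bij_betw_refinements])
         (auto simp: case_prod_unfold)
    finally show ?case .
  qed
  from this[OF parts_pos[of \<beta>]] show ?thesis
    by (simp add: Lam_comp_def parts_inverse)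
qed

lemma pairing_Lam_comp:
  fixes f :: "'k::field series"
  assumes "f \<in> QSym"
  shows "pairing (Lam_comp \<beta>) f = (\<Sum>\<gamma> | \<beta> \<succeq> \<gamma>. composition_sign \<gamma> * f (lead_monomial \<gamma>))"
proof -
  have lookup: "Poly_Mapping.lookup (Lam_comp \<beta> :: 'k nsym) \<gamma> =
      (if \<beta> \<succeq> \<gamma> then composition_sign \<gamma> else 0)" for \<gamma>
    by (simp add: Lam_comp_expansion lookup_sum lookup_single when_def finite_refinements)
  have "pairing (Lam_comp \<beta>) f =
      (\<Sum>\<gamma> \<in> Poly_Mapping.keys (Lam_comp \<beta> :: 'k nsym).
         Poly_Mapping.lookup (Lam_comp \<beta>) \<gamma> * f (lead_monomial \<gamma>))"
    by (simp add: pairing_def M_coordinate[OF assms])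
  also have "\<dots> = (\<Sum>\<gamma> | \<beta> \<succeq> \<gamma>. composition_sign \<gamma> * f (lead_monomial \<gamma>))"
    by (rule sum.mono_neutral_cong_left)
      (auto simp: finite_refinements in_keys_iff lookup split: if_splits)
  finally show ?thesis .
qed

text \<open>Induction from the finest compositions upwards: every proper refinement of \<open>\<alpha>\<close> is longer,
  so in the pairing with \<open>\<Lambda>\<^sub>\<alpha>\<close> only the coordinate at \<open>\<alpha>\<close> is still unknown, and its coefficient
  is a sign.\<close>

lemma Lam_pairing_determines:
  fixes f g :: "'k::field series"
  assumes "f \<in> QSym" "g \<in> QSym" "\<And>\<beta>. pairing (Lam_comp \<beta>) f = pairing (Lam_comp \<beta>) g"
  shows "f = g"
proof (rule QSym_eqI[OF assms(1,2)])
  fix \<alpha>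
  show "f (lead_monomial \<alpha>) = g (lead_monomial \<alpha>)"
  proof (induction "csize \<alpha> - clen \<alpha>" arbitrary: \<alpha> rule: less_induct)
    case less
    let ?R = "{\<gamma>. \<alpha> \<succeq> \<gamma>}"
    have IH: "f (lead_monomial \<gamma>) = g (lead_monomial \<gamma>)" if "\<gamma> \<in> ?R - {\<alpha>}" for \<gamma>
    proof (rule less)
      have "clen \<alpha> < clen \<gamma>" "csize \<alpha> = csize \<gamma>"
        using that coarsens_clen[of \<alpha> \<gamma>] coarsens_csize[of \<alpha> \<gamma>] coarsens_clen_eq[of \<alpha> \<gamma>]
        by (auto simp: le_less)
      then show "csize \<gamma> - clen \<gamma> < csize \<alpha> - clen \<alpha>"
        using clen_le_csize[of \<gamma>] by simp
    qed
    have "(\<Sum>\<gamma>\<in>?R. composition_sign \<gamma> * f (lead_monomial \<gamma>)) =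
          (\<Sum>\<gamma>\<in>?R. composition_sign \<gamma> * g (lead_monomial \<gamma>))"
      using assms by (simp add: pairing_Lam_comp)
    moreover have "(\<Sum>\<gamma>\<in>?R - {\<alpha>}. composition_sign \<gamma> * f (lead_monomial \<gamma>)) =
          (\<Sum>\<gamma>\<in>?R - {\<alpha>}. composition_sign \<gamma> * g (lead_monomial \<gamma>))"
      using IH by (intro sum.cong) auto
    moreover have "\<alpha> \<in> ?R" by (simp add: coarsens_refl)
    ultimately have "(composition_sign \<alpha> :: 'k) * f (lead_monomial \<alpha>) =
        composition_sign \<alpha> * g (lead_monomial \<alpha>)"
      using finite_refinements[of \<alpha>] by (simp add: sum.remove[of ?R \<alpha>])
    then show ?case by (simp add: composition_sign_def)
  qed
qed

section \<open>Specializations\<close>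

lemma D_in_QSym: "D \<alpha> q t \<in> QSym"
  unfolding D_def QSym_def
  by (intro series.span_sum series.span_scale series.span_base) simp

lemma D_coordinate:
  fixes q t :: "'k::field"
  shows "D \<alpha> q t (lead_monomial \<gamma>) = (if \<gamma> \<succeq> \<alpha>
     then q powi (int (clen \<gamma>) - int (csize \<alpha>)) * (- t) ^ (clen \<alpha> - clen \<gamma>) else 0)"
  by (simp add: D_def sum_series_apply scale_def M_lead_monomial finite_coarsens
      if_distrib cong: if_cong)

text \<open>The signs of \<open>\<Lambda>\<^sub>\<beta>\<close> cancel the powers of \<open>q = -1\<close>, so that the pairing with \<open>\<Lambda>\<^sub>\<beta>\<close> is the
  alternating sum over the interval between \<open>\<beta>\<close> and \<open>\<alpha>\<close>.\<close>

lemma D_eq_Lam_dual: "D \<alpha> (- 1) 1 = (Lam_dual \<alpha> :: 'k::field_char_0 series)"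
proof -
  have pair: "pairing (Lam_comp \<beta>) (D \<alpha> (- 1) 1 :: 'k series) = (if \<beta> = \<alpha> then 1 else 0)" for \<beta>
  proof -
    have sign: "(composition_sign \<gamma> :: 'k) * (- 1) powi (int (clen \<gamma>) - int (csize \<alpha>)) = 1"
      if "\<gamma> \<succeq> \<alpha>" for \<gamma>
    proof -
      have "int (clen \<gamma>) - int (csize \<alpha>) = - int (csize \<gamma> - clen \<gamma>)"
        using clen_le_csize[of \<gamma>] coarsens_csize[OF that] by simp
      then show ?thesis
        by (simp add: composition_sign_def power_int_minus)
    qed
    have "pairing (Lam_comp \<beta>) (D \<alpha> (- 1) 1 :: 'k series) =
        (\<Sum>\<gamma> | \<beta> \<succeq> \<gamma>. if \<gamma> \<succeq> \<alpha> then (- 1) ^ (clen \<alpha> - clen \<gamma>) else 0)"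
      unfolding pairing_Lam_comp[OF D_in_QSym]
    proof (intro sum.cong refl)
      fix \<gamma>
      show "composition_sign \<gamma> * D \<alpha> (- 1) 1 (lead_monomial \<gamma>) =
          (if \<gamma> \<succeq> \<alpha> then (- 1) ^ (clen \<alpha> - clen \<gamma>) else 0 :: 'k)"
        using sign[of \<gamma>] by (simp add: D_coordinate flip: mult.assoc)
    qed
    also have "\<dots> = (\<Sum>\<gamma> | \<beta> \<succeq> \<gamma> \<and> \<gamma> \<succeq> \<alpha>. (- 1) ^ (clen \<alpha> - clen \<gamma>))"
      by (subst sum.inter_filter[symmetric]) (simp_all add: finite_refinements)
    finally show ?thesis by (simp add: alternating_sum_composition_interval)
  qed
  show ?thesis
    unfolding Lam_dual_def
    by (rule the_equality[symmetric])
      (auto simp: D_in_QSym pair intro!: Lam_pairing_determines)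
qed

lemma rescaled_D_eq:
  fixes c :: "'k::field"
  assumes "c \<noteq> 0"
  shows "c ^ csize \<alpha> *\<^sub>s D \<alpha> c (- 1) = (\<Sum>\<beta> | \<beta> \<succeq> \<alpha>. c ^ clen \<beta> *\<^sub>s M \<beta>)"
  unfolding D_def series.scale_sum_right
  using assms by (intro sum.cong) (auto simp: power_int_diff)

theorem proposition4p2:
  fixes \<alpha> :: composition and n :: nat and q :: "'k::field_char_0"
  assumes "n = csize \<alpha>"
  shows "D \<alpha> 1 0 = (M \<alpha> :: 'k series) \<and>
         D \<alpha> (- 1) 1 = (Lam_dual \<alpha> :: 'k series) \<and>
         D \<alpha> 1 (- 1) = (essential \<alpha> :: 'k series) \<and>
         2 ^ n *\<^sub>s D \<alpha> 2 (- 1) = (eta \<alpha> :: 'k series) \<and>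
         (q + 1 \<noteq> 0 \<longrightarrow> (q + 1) ^ n *\<^sub>s D \<alpha> (q + 1) (- 1) = eta_q q \<alpha>)"
proof (intro conjI impI)
  have "D \<alpha> 1 0 = (\<Sum>\<beta> | \<beta> \<succeq> \<alpha>. if \<beta> = \<alpha> then M \<beta> else 0 :: 'k series)"
    unfolding D_def
  proof (intro sum.cong refl)
    fix \<beta> assume "\<beta> \<in> {\<beta>. \<beta> \<succeq> \<alpha>}"
    then have "clen \<alpha> - clen \<beta> = 0 \<longleftrightarrow> \<beta> = \<alpha>"
      using coarsens_clen[of \<beta> \<alpha>] coarsens_clen_eq[of \<beta> \<alpha>] by auto
    then show "(1 powi (int (clen \<beta>) - int (csize \<alpha>)) * (- 0) ^ (clen \<alpha> - clen \<beta>)) *\<^sub>s M \<beta> =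
        (if \<beta> = \<alpha> then M \<beta> else 0 :: 'k series)"
      by (auto simp: power_0_left)
  qed
  then show "D \<alpha> 1 0 = (M \<alpha> :: 'k series)"
    by (simp add: finite_coarsens coarsens_refl)
  show "D \<alpha> (- 1) 1 = (Lam_dual \<alpha> :: 'k series)" by (rule D_eq_Lam_dual)
  show "D \<alpha> 1 (- 1) = (essential \<alpha> :: 'k series)"
    using rescaled_D_eq[of "1 :: 'k" \<alpha>] by (simp add: essential_def)
  show "2 ^ n *\<^sub>s D \<alpha> 2 (- 1) = (eta \<alpha> :: 'k series)"
    unfolding eta_def assms by (rule rescaled_D_eq) simp
  assume "q + 1 \<noteq> 0"
  then show "(q + 1) ^ n *\<^sub>s D \<alpha> (q + 1) (- 1) = eta_q q \<alpha>"
    unfolding eta_q_def assms by (rule rescaled_D_eq)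
qed

end
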